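(* Let $D=(A,B,\lambda)$ be an extremally matched temporal bi-clique with $n:=|A|=|B|$. Then $D$ has a bi-spanner of size at most $$\min_{e\in\{\{a,b\}:a\in A,b\in B\}}\Big(b\big(n-\tfrac{|\mathrm{In}(e)|}{2}\big)+b\big(n-\tfrac{|\mathrm{Out}(e)|}{2}\big)+2|\mathrm{In}(e)|+2|\mathrm{Out}(e)|-3\Big).$$
   Context: A temporal bi-clique $(A,B,\lambda)$ is the complete bipartite graph with disjoint parts $A,B$ with an edge labeling $\lambda$ into $\mathbb{N}$. A path $v_1\dots v_k$ is temporal if $\lambda(\{v_i,v_{i+1}\})\le\lambda(\{v_{i+1},v_{i+2}\})$ for all $i\in[k-2]$. A bi-spanner is an edge set $S$ such that every $a\in A$ reaches every $b\in B$ by a temporal path within $S$. $b(m)$ is the minimum number such that every temporal bi-clique with $m$ vertices on each side admits a bi-spanner with at most $b(m)$ edges. For a vertex $v$ with pairwise distinct labels on its incident edges, $\pi^-(v)$ ($\pi^+(v)$) is the neighbor joined to $v$ by the edge of minimum (maximum) label; $D$ is extremally matched if these are well defined and both $\{\{v,\pi^-(v)\}\}$ and $\{\{v,\pi^+(v)\}\}$ (over all vertices $v$) are perfect matchings. For a vertex $v$ and $t\in\mathbb{N}$, $\mathrm{In}_v(t)$ is the set of vertices that reach $v$ by a temporal path all of whose labels are at most $t$, and $\mathrm{Out}_v(t)$ is the set of vertices that $v$ reaches by a temporal path all of whose labels are at least $t$ (both contain $v$). For an edge $e=\{u,v\}$, $\mathrm{In}(e)=\mathrm{In}_u(\lambda(e))\cup\mathrm{In}_v(\lambda(e))$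 and $\mathrm{Out}(e)=\mathrm{Out}_u(\lambda(e))\cup\mathrm{Out}_v(\lambda(e))$. *)

theory Defs
  imports "HOL-Library.Extended_Real"
begin

text \<open>
  A temporal bi-clique \<open>(A, B, L)\<close> is given by two finite disjoint parts and a labeling \<open>L\<close>
  of two-element vertex sets; only the values of \<open>L\<close> on \<open>biclique_edges A B\<close> matter.
\<close>

definition biclique :: "'v set \<Rightarrow> 'v set \<Rightarrow> bool" where
  "biclique A B \<longleftrightarrow> finite A \<and> finite B \<and> A \<inter> B = {}"

definition biclique_edges :: "'v set \<Rightarrow> 'v set \<Rightarrow> 'v set set" where
  "biclique_edges A B = {{a, b} | a b. a \<in> A \<and> b \<in> B}"

definition temporal_path :: "('v set \<Rightarrow> nat) \<Rightarrow> 'v set set \<Rightarrow> 'v list \<Rightarrow> bool" where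
  "temporal_path L S p \<longleftrightarrow>
     p \<noteq> [] \<and> distinct p \<and>
     (\<forall>i. Suc i < length p \<longrightarrow> {p ! i, p ! Suc i} \<in> S) \<and>
     (\<forall>i. Suc (Suc i) < length p \<longrightarrow>
        L {p ! i, p ! Suc i} \<le> L {p ! Suc i, p ! Suc (Suc i)})"

definition reaches :: "('v set \<Rightarrow> nat) \<Rightarrow> 'v set set \<Rightarrow> 'v \<Rightarrow> 'v \<Rightarrow> bool" where
  "reaches L S u v \<longleftrightarrow> (\<exists>p. temporal_path L S p \<and> hd p = u \<and> last p = v)"

definition bi_spanner :: "'v set \<Rightarrow> 'v set \<Rightarrow> ('v set \<Rightarrow> nat) \<Rightarrow> 'v set set \<Rightarrow> bool" where
  "bi_spanner A B L S \<longleftrightarrow>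
     S \<subseteq> biclique_edges A B \<and> (\<forall>a\<in>A. \<forall>b\<in>B. reaches L S a b)"

text \<open>
  A definition cannot quantify over vertex types; every finite bi-clique is isomorphic to one
  whose vertices are natural numbers, so these suffice.
\<close>

definition spanner_bound :: "nat \<Rightarrow> nat" where
  "spanner_bound m = (LEAST k. \<forall>(A :: nat set) B L.
     biclique A B \<and> card A = m \<and> card B = m \<longrightarrow>
       (\<exists>S. bi_spanner A B L S \<and> card S \<le> k))"

definition neighbors :: "'v set \<Rightarrow> 'v set \<Rightarrow> 'v \<Rightarrow> 'v set" where
  "neighbors A B v = {w. {v, w} \<in> biclique_edges A B}"

definition pi_minus :: "'v set \<Rightarrow> 'v set \<Rightarrow> ('v set \<Rightarrow> nat) \<Rightarrow> 'v \<Rightarrow> 'v" where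
  "pi_minus A B L v = arg_min_on (\<lambda>w. L {v, w}) (neighbors A B v)"

definition pi_plus :: "'v set \<Rightarrow> 'v set \<Rightarrow> ('v set \<Rightarrow> nat) \<Rightarrow> 'v \<Rightarrow> 'v" where
  "pi_plus A B L v = arg_max_on (\<lambda>w. L {v, w}) (neighbors A B v)"

definition perfect_matching :: "'v set \<Rightarrow> 'v set \<Rightarrow> 'v set set \<Rightarrow> bool" where
  "perfect_matching A B M \<longleftrightarrow>
     M \<subseteq> biclique_edges A B \<and> (\<forall>v\<in>A \<union> B. \<exists>!e. e \<in> M \<and> v \<in> e)"

definition extremally_matched :: "'v set \<Rightarrow> 'v set \<Rightarrow> ('v set \<Rightarrow> nat) \<Rightarrow> bool" where
  "extremally_matched A B L \<longleftrightarrow>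
     (\<forall>v\<in>A \<union> B. neighbors A B v \<noteq> {} \<and> inj_on (\<lambda>w. L {v, w}) (neighbors A B v)) \<and>
     perfect_matching A B {{v, pi_minus A B L v} | v. v \<in> A \<union> B} \<and>
     perfect_matching A B {{v, pi_plus A B L v} | v. v \<in> A \<union> B}"

definition In_vertex :: "'v set \<Rightarrow> 'v set \<Rightarrow> ('v set \<Rightarrow> nat) \<Rightarrow> 'v \<Rightarrow> nat \<Rightarrow> 'v set" where
  "In_vertex A B L v t = {w. reaches L {e \<in> biclique_edges A B. L e \<le> t} w v}"

definition Out_vertex :: "'v set \<Rightarrow> 'v set \<Rightarrow> ('v set \<Rightarrow> nat) \<Rightarrow> 'v \<Rightarrow> nat \<Rightarrow> 'v set" where
  "Out_vertex A B L v t = {w. reaches L {e \<in> biclique_edges A B. t \<le> L e} v w}"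

definition In_edge :: "'v set \<Rightarrow> 'v set \<Rightarrow> ('v set \<Rightarrow> nat) \<Rightarrow> 'v set \<Rightarrow> 'v set" where
  "In_edge A B L e = (\<Union>v\<in>e. In_vertex A B L v (L e))"

definition Out_edge :: "'v set \<Rightarrow> 'v set \<Rightarrow> ('v set \<Rightarrow> nat) \<Rightarrow> 'v set \<Rightarrow> 'v set" where
  "Out_edge A B L e = (\<Union>v\<in>e. Out_vertex A B L v (L e))"


subsection \<open>The minimum defining the spanner bound exists\<close>

lemma bi_spanner_all_edges:
  assumes "biclique A B"
  shows "bi_spanner A B L (biclique_edges A B)"
  unfolding bi_spanner_def reaches_def
proof (intro conjI ballI order_refl)
  fix a b assume ab: "a \<in> A" "b \<in> B"
  then have "temporal_path L (biclique_edges A B) [a, b]"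
    using assms by (auto simp: temporal_path_def biclique_edges_def biclique_def less_Suc_eq)
  then show "\<exists>p. temporal_path L (biclique_edges A B) p \<and> hd p = a \<and> last p = b"
    by (intro exI[of _ "[a, b]"]) auto
qed

lemma card_biclique_edges_le:
  assumes "biclique A B"
  shows "card (biclique_edges A B) \<le> card A * card B"
proof -
  have "biclique_edges A B = (\<lambda>(a, b). {a, b}) ` (A \<times> B)"
    by (auto simp: biclique_edges_def)
  then show ?thesis
    using assms card_image_le[of "A \<times> B" "\<lambda>(a, b). {a, b}"]
    by (simp add: biclique_def card_cartesian_product)
qed

lemma spanner_bound:
  fixes A B :: "nat set"
  assumes "biclique A B" "card A = m" "card B = m"
  shows "\<exists>S. bi_spanner A B L S \<and> card S \<le> spanner_bound m"
proof -
  let ?P = "\<lambda>k. \<forall>(A :: nat set) B L. biclique A B \<and> card A = m \<and> card B = m \<longrightarrow>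
       (\<exists>S. bi_spanner A B L S \<and> card S \<le> k)"
  have "?P (m * m)"
    using bi_spanner_all_edges card_biclique_edges_le by metis
  then have "?P (spanner_bound m)"
    unfolding spanner_bound_def by (rule LeastI)
  with assms show ?thesis by blast
qed


subsection \<open>The sets attached to an edge have even cardinality\<close>

lemma edge_subset: "e \<in> biclique_edges A B \<Longrightarrow> e \<subseteq> A \<union> B"
  by (auto simp: biclique_edges_def)

lemma perfect_matching_unique:
  assumes "perfect_matching A B M" "v \<in> A \<union> B" "e \<in> M" "v \<in> e" "f \<in> M" "v \<in> f"
  shows "e = f"
  using assms unfolding perfect_matching_def by blast

lemma perfect_matching_edge: "perfect_matching A B M \<Longrightarrow> e \<in> M \<Longrightarrow> e \<in> biclique_edges A B"
  by (auto simp: perfect_matching_def)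

lemma even_card_matching_closed:
  assumes bc: "biclique A B" and M: "perfect_matching A B M" and X: "X \<subseteq> A \<union> B"
    and closed: "\<And>e w. e \<in> M \<Longrightarrow> w \<in> e \<Longrightarrow> w \<in> X \<Longrightarrow> e \<subseteq> X"
  shows "even (card X)"
proof -
  let ?C = "{e \<in> M. e \<subseteq> X}"
  have fin: "finite X" using bc X finite_subset by (auto simp: biclique_def)
  have U: "\<Union>?C = X"
  proof
    show "X \<subseteq> \<Union>?C"
    proof
      fix w assume "w \<in> X"
      moreover then obtain e where "e \<in> M" "w \<in> e"
        using M X unfolding perfect_matching_def by blast
      ultimately show "w \<in> \<Union>?C" using closed by blast
    qed
  qed auto
  have "finite ?C" using fin by (auto intro: finite_subset[of _ "Pow X"])
  moreover have "card e = 2" if e: "e \<in> ?C" for e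
  proof -
    obtain a b where "e = {a, b}" "a \<in> A" "b \<in> B"
      using e perfect_matching_edge[OF M, of e] by (auto simp: biclique_edges_def)
    moreover from this have "a \<noteq> b" using bc by (auto simp: biclique_def)
    ultimately show ?thesis by simp
  qed
  moreover have "e \<inter> f = {}" if "e \<in> ?C" "f \<in> ?C" "e \<noteq> f" for e f
    using that perfect_matching_unique[OF M, of _ e f] X by blast
  ultimately have "2 * card ?C = card (\<Union>?C)"
    using fin U by (intro card_partition) auto
  then show ?thesis using U by (metis dvd_triv_left)
qed

lemma temporal_path_Cons:
  assumes "temporal_path L S p" "x \<notin> set p" "{x, hd p} \<in> S"
    "Suc 0 < length p \<Longrightarrow> L {x, hd p} \<le> L {p ! 0, p ! Suc 0}"
  shows "temporal_path L S (x # p)"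
  using assms by (auto simp: temporal_path_def nth_Cons hd_conv_nth split: nat.splits)

lemma temporal_path_snoc:
  assumes "temporal_path L S p" "x \<notin> set p" "{last p, x} \<in> S"
    "Suc 0 < length p \<Longrightarrow> L {p ! (length p - 2), last p} \<le> L {last p, x}"
  shows "temporal_path L S (p @ [x])"
proof -
  have ne: "p \<noteq> []" using assms by (simp add: temporal_path_def)
  have lst: "last p = p ! (length p - 1)" using ne by (simp add: last_conv_nth)
  show ?thesis
    unfolding temporal_path_def
  proof (intro conjI allI impI)
    show "distinct (p @ [x])" using assms by (simp add: temporal_path_def)
    fix i
    show "{(p @ [x]) ! i, (p @ [x]) ! Suc i} \<in> S" if "Suc i < length (p @ [x])"
    proof (cases "Suc i < length p")
      case True
      then show ?thesis using assms by (simp add: temporal_path_def nth_append)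
    next
      case False
      then have "length p = Suc i" using that by simp
      then show ?thesis using assms(3) lst by (simp add: nth_append)
    qed
    show "L {(p @ [x]) ! i, (p @ [x]) ! Suc i}
        \<le> L {(p @ [x]) ! Suc i, (p @ [x]) ! Suc (Suc i)}"
      if "Suc (Suc i) < length (p @ [x])"
    proof (cases "Suc (Suc i) < length p")
      case True
      then show ?thesis using assms by (simp add: temporal_path_def nth_append)
    next
      case False
      then have "length p = Suc (Suc i)" using that by simp
      then show ?thesis using assms(4) lst by (simp add: nth_append)
    qed
  qed simp
qed

lemma temporal_path_drop:
  assumes "temporal_path L S p" "k < length p"
  shows "temporal_path L S (drop k p)"
  using assms by (auto simp: temporal_path_def)

lemma temporal_path_take:
  assumes "temporal_path L S p" "0 < k" "k \<le> length p"
  shows "temporal_path L S (take k p)"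
  using assms by (auto simp: temporal_path_def)

lemma temporal_path_subset:
  assumes "temporal_path L S p" "S \<subseteq> biclique_edges A B" "v \<in> A \<union> B" "v \<in> set p"
  shows "set p \<subseteq> A \<union> B"
proof
  fix w assume "w \<in> set p"
  then obtain i where i: "i < length p" "w = p ! i" by (auto simp: in_set_conv_nth)
  consider "length p = 1" | "Suc i < length p" | "i = length p - 1" "Suc 0 < length p"
    using i by linarith
  then show "w \<in> A \<union> B"
  proof cases
    case 1
    then have "w = v" using assms(4) i by (auto simp: in_set_conv_nth)
    then show ?thesis using assms by simp
  next
    case 2
    then have "{w, p ! Suc i} \<in> biclique_edges A B"
      using assms i by (auto simp: temporal_path_def)
    then show ?thesis using edge_subset by blast
  next
    case 3
    then have "{p ! (i - 1), p ! Suc (i - 1)} \<in> biclique_edges A B" "Suc (i - 1) = i"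
      using assms(1,2) by (auto simp: temporal_path_def)
    then show ?thesis using edge_subset i by (metis insert_subset)
  qed
qed

lemma finite_neighbors: "biclique A B \<Longrightarrow> finite (neighbors A B v)"
  by (rule finite_subset[of _ "A \<union> B"])
     (auto simp: biclique_def neighbors_def dest: edge_subset)

lemma pi_minus_le:
  assumes "biclique A B" "{v, w} \<in> biclique_edges A B"
  shows "L {v, pi_minus A B L v} \<le> L {v, w}"
  using assms arg_min_least[of "neighbors A B v" w "\<lambda>w. L {v, w}"] finite_neighbors[OF assms(1)]
  unfolding pi_minus_def by (auto simp: neighbors_def)

lemma pi_plus_ge:
  assumes "biclique A B" "{v, w} \<in> biclique_edges A B"
  shows "L {v, w} \<le> L {v, pi_plus A B L v}"
proof -
  let ?f = "\<lambda>w. L {v, w}"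
  have "\<forall>y. y \<in> neighbors A B v \<longrightarrow> ?f y < Suc (Max (?f ` neighbors A B v))"
    using finite_neighbors[OF assms(1)] by (simp add: less_Suc_eq_le)
  then have "?f w \<le> ?f (arg_max ?f (\<lambda>w. w \<in> neighbors A B v))"
    using assms(2) by (intro arg_max_nat_le) (auto simp: neighbors_def)
  then show ?thesis by (simp add: pi_plus_def arg_max_on_def)
qed

lemma In_edge_subset:
  assumes "e \<in> biclique_edges A B"
  shows "In_edge A B L e \<subseteq> A \<union> B"
proof
  fix w assume "w \<in> In_edge A B L e"
  then obtain x p where *: "x \<in> e"
    "temporal_path L {f \<in> biclique_edges A B. L f \<le> L e} p" "hd p = w" "last p = x"
    by (auto simp: In_edge_def In_vertex_def reaches_def)
  then have "p \<noteq> []" by (simp add: temporal_path_def)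
  with * show "w \<in> A \<union> B"
    using temporal_path_subset[OF *(2), of A B x] edge_subset[OF assms]
      hd_in_set[of p] last_in_set[of p] by auto
qed

lemma Out_edge_subset:
  assumes "e \<in> biclique_edges A B"
  shows "Out_edge A B L e \<subseteq> A \<union> B"
proof
  fix w assume "w \<in> Out_edge A B L e"
  then obtain x p where *: "x \<in> e"
    "temporal_path L {f \<in> biclique_edges A B. L e \<le> L f} p" "hd p = x" "last p = w"
    by (auto simp: Out_edge_def Out_vertex_def reaches_def)
  then have "p \<noteq> []" by (simp add: temporal_path_def)
  with * show "w \<in> A \<union> B"
    using temporal_path_subset[OF *(2), of A B x] edge_subset[OF assms]
      hd_in_set[of p] last_in_set[of p] by auto
qed

lemma edge_subset_In_edge: "e \<subseteq> In_edge A B L e"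
  by (auto simp: In_edge_def In_vertex_def reaches_def temporal_path_def intro!: exI[of _ "[_]"])

lemma edge_subset_Out_edge: "e \<subseteq> Out_edge A B L e"
  by (auto simp: Out_edge_def Out_vertex_def reaches_def temporal_path_def intro!: exI[of _ "[_]"])

lemma edge_other_end:
  assumes "e \<in> biclique_edges A B" "x \<in> e"
  obtains y where "e = {x, y}"
  using assms by (auto simp: biclique_edges_def)

lemma pi_minus_In_edge:
  assumes bc: "biclique A B" and e: "e \<in> biclique_edges A B"
    and w: "w \<in> In_edge A B L e" and nb: "{w, pi_minus A B L w} \<in> biclique_edges A B"
  shows "pi_minus A B L w \<in> In_edge A B L e"
proof -
  let ?S = "{f \<in> biclique_edges A B. L f \<le> L e}"
  let ?y = "pi_minus A B L w"
  obtain x p where x: "x \<in> e" and p: "temporal_path L ?S p" "hd p = w" "last p = x"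
    using w by (auto simp: In_edge_def In_vertex_def reaches_def)
  have ne: "p \<noteq> []" using p by (simp add: temporal_path_def)
  have "\<exists>q. temporal_path L ?S q \<and> hd q = ?y \<and> last q = x"
  proof (cases "?y \<in> set p")
    case True
    then obtain k where k: "k < length p" "p ! k = ?y" by (auto simp: in_set_conv_nth)
    then show ?thesis using temporal_path_drop[OF p(1) k(1)] p
      by (intro exI[of _ "drop k p"]) (auto simp: hd_drop_conv_nth)
  next
    case False
    have w0: "p ! 0 = w" using p ne by (simp add: hd_conv_nth)
    have first: "{p ! 0, p ! Suc 0} \<in> ?S" if "Suc 0 < length p"
      using p(1) that by (auto simp: temporal_path_def)
    have le: "L {w, ?y} \<le> L {p ! 0, p ! Suc 0}" if "Suc 0 < length p"
      using first[OF that] w0 pi_minus_le[OF bc] by auto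
    have "L {w, ?y} \<le> L e"
    proof (cases "Suc 0 < length p")
      case True
      then show ?thesis using le first by fastforce
    next
      case False
      then have "w = x" using ne p by (cases p) auto
      then obtain z where "e = {w, z}" using edge_other_end[OF e x] by metis
      then show ?thesis using pi_minus_le[OF bc] e by auto
    qed
    then have "temporal_path L ?S (?y # p)"
      using temporal_path_Cons[OF p(1) False] nb p(2) le by (simp add: insert_commute)
    then show ?thesis using p ne by (intro exI[of _ "?y # p"]) auto
  qed
  then show ?thesis using x by (auto simp: In_edge_def In_vertex_def reaches_def)
qed

lemma pi_plus_Out_edge:
  assumes bc: "biclique A B" and e: "e \<in> biclique_edges A B"
    and w: "w \<in> Out_edge A B L e" and nb: "{w, pi_plus A B L w} \<in> biclique_edges A B"
  shows "pi_plus A B L w \<in> Out_edge A B L e"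
proof -
  let ?S = "{f \<in> biclique_edges A B. L e \<le> L f}"
  let ?y = "pi_plus A B L w"
  obtain x p where x: "x \<in> e" and p: "temporal_path L ?S p" "hd p = x" "last p = w"
    using w by (auto simp: Out_edge_def Out_vertex_def reaches_def)
  have ne: "p \<noteq> []" using p by (simp add: temporal_path_def)
  have "\<exists>q. temporal_path L ?S q \<and> hd q = x \<and> last q = ?y"
  proof (cases "?y \<in> set p")
    case True
    then obtain k where k: "k < length p" "p ! k = ?y" by (auto simp: in_set_conv_nth)
    then show ?thesis using temporal_path_take[OF p(1), of "Suc k"] p hd_conv_nth[OF ne]
      by (intro exI[of _ "take (Suc k) p"]) (auto simp: take_Suc_conv_app_nth hd_append)
  next
    case False
    have lst: "last p = p ! (length p - 1)" using ne by (simp add: last_conv_nth)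
    have final: "{p ! (length p - 2), w} \<in> ?S" if "Suc 0 < length p"
    proof -
      have "Suc (length p - 2) = length p - 1" using that by simp
      moreover have "{p ! (length p - 2), p ! Suc (length p - 2)} \<in> ?S"
        using p(1) that unfolding temporal_path_def by (metis calculation diff_less ne
            length_greater_0_conv less_numeral_extra(1))
      ultimately show ?thesis using lst p(3) by simp
    qed
    have le: "L {p ! (length p - 2), w} \<le> L {w, ?y}" if "Suc 0 < length p"
      using final[OF that] pi_plus_ge[OF bc, of w "p ! (length p - 2)" L]
      by (simp add: insert_commute)
    have "L e \<le> L {w, ?y}"
    proof (cases "Suc 0 < length p")
      case True
      then show ?thesis using le final by fastforce
    next
      case False
      then have "w = x" using ne p by (cases p) auto
      then obtain z where "e = {w, z}" using edge_other_end[OF e x] by metis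
      then show ?thesis using pi_plus_ge[OF bc] e by auto
    qed
    then have "temporal_path L ?S (p @ [?y])"
      using temporal_path_snoc[OF p(1) False] nb p(3) le by simp
    then show ?thesis using p ne by (intro exI[of _ "p @ [?y]"]) auto
  qed
  then show ?thesis using x by (auto simp: Out_edge_def Out_vertex_def reaches_def)
qed

lemma even_card_In_edge:
  assumes bc: "biclique A B" and m: "extremally_matched A B L" and e: "e \<in> biclique_edges A B"
  shows "even (card (In_edge A B L e))"
proof -
  let ?M = "{{v, pi_minus A B L v} | v. v \<in> A \<union> B}"
  have M: "perfect_matching A B ?M" using m unfolding extremally_matched_def by (elim conjE)
  show ?thesis
  proof (rule even_card_matching_closed[OF bc M In_edge_subset[OF e]])
    fix f w assume f: "f \<in> ?M" "w \<in> f" and w: "w \<in> In_edge A B L e"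
    have wV: "w \<in> A \<union> B" using w In_edge_subset[OF e] by blast
    then have g: "{w, pi_minus A B L w} \<in> ?M" by blast
    then have "f = {w, pi_minus A B L w}"
      by (rule perfect_matching_unique[OF M wV f _ insertI1])
    moreover have "{w, pi_minus A B L w} \<in> biclique_edges A B"
      using perfect_matching_edge[OF M g] .
    ultimately show "f \<subseteq> In_edge A B L e" using pi_minus_In_edge[OF bc e w] w by simp
  qed
qed

lemma even_card_Out_edge:
  assumes bc: "biclique A B" and m: "extremally_matched A B L" and e: "e \<in> biclique_edges A B"
  shows "even (card (Out_edge A B L e))"
proof -
  let ?M = "{{v, pi_plus A B L v} | v. v \<in> A \<union> B}"
  have M: "perfect_matching A B ?M" using m unfolding extremally_matched_def by (elim conjE)
  show ?thesis
  proof (rule even_card_matching_closed[OF bc M Out_edge_subset[OF e]])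
    fix f w assume f: "f \<in> ?M" "w \<in> f" and w: "w \<in> Out_edge A B L e"
    have wV: "w \<in> A \<union> B" using w Out_edge_subset[OF e] by blast
    then have g: "{w, pi_plus A B L w} \<in> ?M" by blast
    then have "f = {w, pi_plus A B L w}"
      by (rule perfect_matching_unique[OF M wV f _ insertI1])
    moreover have "{w, pi_plus A B L w} \<in> biclique_edges A B"
      using perfect_matching_edge[OF M g] .
    ultimately show "f \<subseteq> Out_edge A B L e" using pi_plus_Out_edge[OF bc e w] w by simp
  qed
qed

lemma half_card_le:
  assumes "biclique A B" "card A = n" "card B = n" "X \<subseteq> A \<union> B"
  shows "card X div 2 \<le> n"
proof -
  have "card X \<le> card (A \<union> B)" using assms by (intro card_mono) (auto simp: biclique_def)
  also have "\<dots> \<le> 2 * n" using card_Un_le[of A B] assms by simp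
  finally show ?thesis by simp
qed

end

theory Submission
  imports Defs
begin

text \<open>
  Fix an edge \<open>e\<close>. A latest-departure tree into \<open>e\<close> and an earliest-arrival tree out of \<open>e\<close>,
  sharing the edge \<open>e\<close>, connect all of \<open>In(e)\<close> to all of \<open>Out(e)\<close> with \<open>|In(e)| + |Out(e)| - 3\<close>
  edges. The sources outside \<open>In(e)\<close> number \<open>m = n - |In(e)| / 2\<close>, because \<open>In(e)\<close> is closed under the
  matching \<open>\<pi>\<^sup>-\<close>. They reach all \<open>n\<close> targets with \<open>b(m) + 2 (n - m)\<close> edges: as long as there are more
  targets than sources, two targets have their latest edge at the same source, and one of them is
  then served through the other at the cost of two edges. Reversing time treats the targets
  outside \<open>Out(e)\<close>.
\<close>

section \<open>Temporal walks\<close>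

text \<open>
  \<open>twalk L S t u s v\<close>: a temporal walk, possibly repeating vertices, from \<open>u\<close> to \<open>v\<close> with all labels
  between \<open>t\<close> and \<open>s\<close>. Unlike temporal paths, these compose freely.
\<close>

inductive twalk :: "('v set \<Rightarrow> nat) \<Rightarrow> 'v set set \<Rightarrow> nat \<Rightarrow> 'v \<Rightarrow> nat \<Rightarrow> 'v \<Rightarrow> bool"
  for L S where
  refl: "t \<le> s \<Longrightarrow> twalk L S t v s v"
| step: "{u, v} \<in> S \<Longrightarrow> t \<le> L {u, v} \<Longrightarrow> twalk L S (L {u, v}) v s w \<Longrightarrow> twalk L S t u s w"

lemma twalk_le: "twalk L S t u s v \<Longrightarrow> t \<le> s"
  by (induction rule: twalk.induct) auto

lemma twalk_trans:
  "twalk L S t u s v \<Longrightarrow> twalk L S s v r w \<Longrightarrow> twalk L S t u r w"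
proof (induction rule: twalk.induct)
  case (refl t s v)
  \<comment> \<open>Only the first edge of the second walk is compared with its start time, so that
    time may be lowered from \<open>s\<close> to \<open>t\<close>.\<close>
  from refl(2,1) show ?case
    by (cases rule: twalk.cases) (auto intro: twalk.intros)
qed (auto intro: twalk.step)

lemma twalk_mono: "twalk L S t u s v \<Longrightarrow> S \<subseteq> S' \<Longrightarrow> twalk L S' t u s v"
  by (induction rule: twalk.induct) (auto intro: twalk.intros)

lemma twalk_edge: "{u, v} \<in> S \<Longrightarrow> t \<le> L {u, v} \<Longrightarrow> L {u, v} \<le> s \<Longrightarrow> twalk L S t u s v"
  by (rule twalk.step[OF _ _ twalk.refl])

text \<open>Labels never decrease along a walk, so its last edge, which lies at \<open>v\<close>,
  bounds all of them. The disjunction covers the walk without edges, where \<open>t\<close> itself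
  must not exceed \<open>r\<close>.\<close>

lemma twalk_end_bounded:
  "twalk L S t u s v \<Longrightarrow> \<forall>f\<in>S. v \<in> f \<longrightarrow> L f \<le> r \<Longrightarrow> u \<noteq> v \<or> t \<le> r \<Longrightarrow> twalk L S t u r v"
proof (induction rule: twalk.induct)
  case (step u v t s w)
  have "v \<noteq> w \<or> L {u, v} \<le> r" using step by auto
  with step show ?case by (auto intro: twalk.step)
qed (auto intro: twalk.refl)

text \<open>For growing a tree on \<open>X\<close>: it extracts an edge crossing into
  \<open>X\<close> and the time at which the walk continues from inside.\<close>

lemma twalk_enters:
  "twalk L S t u s v \<Longrightarrow> u \<notin> X \<Longrightarrow> v \<in> X \<Longrightarrow>
    \<exists>y z. y \<notin> X \<and> z \<in> X \<and> {y, z} \<in> S \<and> t \<le> L {y, z} \<and> twalk L S (L {y, z}) z s v"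
proof (induction rule: twalk.induct)
  case (step u v t s w)
  show ?case
  proof (cases "v \<in> X")
    case False
    with step obtain y z where "y \<notin> X" "z \<in> X" "{y, z} \<in> S" "L {u, v} \<le> L {y, z}"
      "twalk L S (L {y, z}) z s w" by blast
    with step(2) show ?thesis by (meson le_trans)
  qed (use step in blast)
qed simp

text \<open>Reading a walk backwards turns each time \<open>t\<close> into \<open>M - t\<close>, so
  facts about sources become facts about targets.\<close>

lemma twalk_reverse:
  assumes "twalk L S t u s v" "\<forall>f\<in>S. L f + L' f = M" "s \<le> M"
  shows "twalk L' S (M - s) v (M - t) u"
  using assms
proof (induction rule: twalk.induct)
  case (refl t s v)
  then show ?case by (auto intro: twalk.refl)
next
  case (step u v t s w)
  have eq: "L {u, v} + L' {u, v} = M" using step by blast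
  have "twalk L' S (M - L {u, v}) v (M - t) u"
    using step(1,2) eq by (intro twalk_edge) (auto simp: insert_commute)
  with step show ?case using twalk_trans[of L' S "M - s" w "M - L {u, v}" v] by simp
qed

lemma twalk_image:
  "twalk L S t u s v \<Longrightarrow> \<forall>f\<in>S. L f = L' (g ` f) \<Longrightarrow> twalk L' ((`) g ` S) t (g u) s (g v)"
proof (induction rule: twalk.induct)
  case (step u v t s w)
  have eq: "{g u, g v} = g ` {u, v}" by simp
  have "{g u, g v} \<in> (`) g ` S" "L' {g u, g v} = L {u, v}"
    unfolding eq using step.hyps(1) step.prems by (blast, metis)
  then show ?case using step.hyps(2) step.IH[OF step.prems] twalk.step[of "g u" "g v"] by metis
qed (auto intro: twalk.refl)

section \<open>Walks versus temporal paths\<close>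

lemma temporal_path_mono: "temporal_path L S p \<Longrightarrow> S \<subseteq> S' \<Longrightarrow> temporal_path L S' p"
  by (auto simp: temporal_path_def)

lemma reaches_mono: "reaches L S u v \<Longrightarrow> S \<subseteq> S' \<Longrightarrow> reaches L S' u v"
  unfolding reaches_def by (blast intro: temporal_path_mono)

text \<open>If the new first vertex already lies on the path, the path is cut to start there. The
  filtered edge set keeps the time window.\<close>

lemma twalk_imp_reaches:
  "twalk L S t u s v \<Longrightarrow> reaches L {f \<in> S. t \<le> L f \<and> L f \<le> s} u v"
proof (induction rule: twalk.induct)
  case (refl t s v)
  then show ?case
    by (auto simp: reaches_def temporal_path_def intro!: exI[of _ "[v]"])
next
  case (step u v t s w)
  let ?S = "{f \<in> S. t \<le> L f \<and> L f \<le> s}"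
  obtain p where p: "temporal_path L {f \<in> S. L {u, v} \<le> L f \<and> L f \<le> s} p" "hd p = v" "last p = w"
    using step by (auto simp: reaches_def)
  have ne: "p \<noteq> []" using p by (simp add: temporal_path_def)
  have p': "temporal_path L ?S p"
    by (rule temporal_path_mono[OF p(1)]) (use step(2) in auto)
  show ?case
  proof (cases "u \<in> set p")
    case True
    then obtain k where k: "k < length p" "p ! k = u" by (auto simp: in_set_conv_nth)
    then show ?thesis using temporal_path_drop[OF p' k(1)] p
      unfolding reaches_def by (intro exI[of _ "drop k p"]) (auto simp: hd_drop_conv_nth)
  next
    case False
    have "{u, v} \<in> ?S" using step twalk_le[OF step(3)] by simp
    moreover have "L {u, v} \<le> L {p ! 0, p ! Suc 0}" if "Suc 0 < length p"
      using p(1) that by (auto simp: temporal_path_def)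
    ultimately have "temporal_path L ?S (u # p)"
      using temporal_path_Cons[OF p' False] p(2) by auto
    then show ?thesis using p ne
      unfolding reaches_def by (intro exI[of _ "u # p"]) auto
  qed
qed

text \<open>Bounding only the first edge from below suffices, as later labels are no smaller; for
  the tail, \<open>t\<close> becomes the label of that first edge.\<close>

lemma temporal_path_imp_twalk:
  assumes "temporal_path L S p" "\<forall>f\<in>S. L f \<le> s" "t \<le> s"
    "Suc 0 < length p \<Longrightarrow> t \<le> L {p ! 0, p ! Suc 0}"
  shows "twalk L S t (hd p) s (last p)"
  using assms
proof (induction p arbitrary: t)
  case (Cons x p)
  show ?case
  proof (cases p)
    case Nil
    then show ?thesis using Cons by (auto intro: twalk.refl)
  next
    case (Cons y q)
    have 1: "{x, y} \<in> S" using Cons.prems(1) Cons by (auto simp: temporal_path_def)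
    have 2: "temporal_path L S p"
      using temporal_path_drop[OF Cons.prems(1), of 1] Cons by simp
    have 3: "L {x, y} \<le> L {p ! 0, p ! Suc 0}" if "Suc 0 < length p"
      using Cons.prems(1) that Cons unfolding temporal_path_def by (auto dest: spec[of _ 0])
    have "twalk L S (L {x, y}) (hd p) s (last p)"
      using Cons.IH[OF 2 Cons.prems(2) _ 3] 1 Cons.prems(2) by blast
    then show ?thesis using 1 Cons.prems(4) Cons by (auto intro: twalk.step)
  qed
qed (simp add: temporal_path_def)

lemma reaches_imp_twalk:
  assumes "reaches L S u v" "\<forall>f\<in>S. t \<le> L f \<and> L f \<le> s" "t \<le> s"
  shows "twalk L S t u s v"
  using assms temporal_path_imp_twalk[of L S _ s t]
  by (auto simp: reaches_def temporal_path_def)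

lemma reaches_iff_twalk:
  assumes "\<forall>f\<in>S. L f \<le> M"
  shows "reaches L S u v \<longleftrightarrow> twalk L S 0 u M v"
  using assms reaches_imp_twalk[of L S u v 0 M] twalk_imp_reaches[of L S 0 u M v]
  by (auto elim: reaches_mono)

lemma twalk_le_iff_reaches:
  "twalk L S 0 u s v \<longleftrightarrow> reaches L {f \<in> S. L f \<le> s} u v"
proof
  show "twalk L S 0 u s v" if "reaches L {f \<in> S. L f \<le> s} u v"
    using reaches_imp_twalk[OF that, of 0 s] by (auto elim: twalk_mono)
qed (use twalk_imp_reaches in fastforce)

lemma twalk_ge_iff_reaches:
  assumes "\<forall>f\<in>S. L f \<le> M" "t \<le> M"
  shows "twalk L S t u M v \<longleftrightarrow> reaches L {f \<in> S. t \<le> L f} u v"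
proof
  show "twalk L S t u M v" if "reaches L {f \<in> S. t \<le> L f} u v"
    using reaches_imp_twalk[OF that, of t M] assms by (auto elim: twalk_mono)
  show "reaches L {f \<in> S. t \<le> L f} u v" if "twalk L S t u M v"
    using twalk_imp_reaches[OF that] by (rule reaches_mono) auto
qed

section \<open>Bi-spanners under time reversal and change of vertex type\<close>

lemma biclique_edges_commute: "biclique_edges A B = biclique_edges B A"
  by (auto simp: biclique_edges_def insert_commute)

lemma biclique_commute: "biclique A B \<Longrightarrow> biclique B A"
  by (auto simp: biclique_def)

lemma finite_biclique_edges: "biclique A B \<Longrightarrow> finite (biclique_edges A B)"
  by (rule finite_subset[of _ "Pow (A \<union> B)"]) (auto simp: biclique_def biclique_edges_def)

lemma biclique_edges_mono: "A \<subseteq> A' \<Longrightarrow> B \<subseteq> B' \<Longrightarrow> biclique_edges A B \<subseteq> biclique_edges A' B'"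
  by (auto simp: biclique_edges_def)

lemma labels_bounded:
  assumes "biclique A B"
  obtains M :: nat where "\<forall>f\<in>biclique_edges A B. L f \<le> M"
proof
  show "\<forall>f\<in>biclique_edges A B. L f \<le> Max (L ` biclique_edges A B)"
    using finite_biclique_edges[OF assms] by simp
qed

lemma bi_spanner_iff_twalk:
  assumes "\<forall>f\<in>biclique_edges A B. L f \<le> M"
  shows "bi_spanner A B L S \<longleftrightarrow>
    S \<subseteq> biclique_edges A B \<and> (\<forall>a\<in>A. \<forall>b\<in>B. twalk L S 0 a M b)"
proof (cases "S \<subseteq> biclique_edges A B")
  case True
  with assms have "\<forall>f\<in>S. L f \<le> M" by blast
  then show ?thesis by (simp add: bi_spanner_def reaches_iff_twalk[of S L M])
qed (simp add: bi_spanner_def)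

text \<open>Complementing labels reverses walks, so the parts exchange their roles as sources and
  targets.\<close>

lemma bi_spanner_reverse:
  assumes sum: "\<forall>f\<in>biclique_edges A B. L f + L' f = M"
    and S: "bi_spanner B A L' S"
  shows "bi_spanner A B L S"
proof -
  have le: "\<forall>f\<in>biclique_edges A B. L f \<le> M" "\<forall>f\<in>biclique_edges B A. L' f \<le> M"
    using sum unfolding biclique_edges_commute[of B A] by (metis le_add1, metis le_add2)
  have sub: "S \<subseteq> biclique_edges A B"
    using S unfolding bi_spanner_def biclique_edges_commute[of B A] by blast
  have "twalk L S 0 a M b" if "a \<in> A" "b \<in> B" for a b
  proof -
    have "twalk L' S 0 b M a" using that S bi_spanner_iff_twalk[OF le(2)] by blast
    then show ?thesis using twalk_reverse[of L' S 0 b M a L M] sum sub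
      by (auto simp: add.commute)
  qed
  then show ?thesis using sub bi_spanner_iff_twalk[OF le(1)] by blast
qed

text \<open>\<open>spanner_bound\<close> ranges over natural-number vertices. An injection
  \<open>h\<close> carries the bi-clique there, and its inverse \<open>g\<close> carries a spanner
  back.\<close>

lemma spanner_bound_any_type:
  assumes bc: "biclique A B" and cards: "card A = m" "card B = m"
  shows "\<exists>S. bi_spanner A B L S \<and> finite S \<and> card S \<le> spanner_bound m"
proof -
  have fin: "finite (A \<union> B)" using bc by (simp add: biclique_def)
  then obtain h :: "'a \<Rightarrow> nat" where h: "inj_on h (A \<union> B)"
    using finite_imp_inj_to_nat_seg by metis
  define g where "g = inv_into (A \<union> B) h"
  have gh: "g (h x) = x" if "x \<in> A \<union> B" for x
    using h that by (simp add: g_def inv_into_f_f)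
  have "h ` A \<inter> h ` B = h ` (A \<inter> B)"
    using h by (simp add: inj_on_image_Int[of h "A \<union> B"])
  then have bc': "biclique (h ` A) (h ` B)" using bc by (simp add: biclique_def)
  have "card (h ` A) = m" "card (h ` B) = m"
    using h cards by (auto simp: card_image inj_on_subset)
  from spanner_bound[OF bc' this, of "\<lambda>f. L (g ` f)"]
  obtain S where S: "bi_spanner (h ` A) (h ` B) (\<lambda>f. L (g ` f)) S" "card S \<le> spanner_bound m"
    by blast
  have finS: "finite S"
    using S finite_biclique_edges[OF bc'] finite_subset by (auto simp: bi_spanner_def)
  obtain M where M: "\<forall>f\<in>biclique_edges A B. L f \<le> M" using labels_bounded[OF bc] .
  have img: "g ` f \<in> biclique_edges A B" if f: "f \<in> biclique_edges (h ` A) (h ` B)" for f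
  proof -
    obtain a b where "f = {h a, h b}" "a \<in> A" "b \<in> B"
      using f unfolding biclique_edges_def by blast
    then have "g ` f = {a, b}" "a \<in> A" "b \<in> B" using gh by auto
    then show ?thesis unfolding biclique_edges_def by blast
  qed
  then have M': "\<forall>f\<in>biclique_edges (h ` A) (h ` B). L (g ` f) \<le> M" using M by blast
  have sub: "(`) g ` S \<subseteq> biclique_edges A B"
    using S(1) img by (auto simp: bi_spanner_def)
  have "twalk L ((`) g ` S) 0 a M b" if "a \<in> A" "b \<in> B" for a b
  proof -
    have "twalk (\<lambda>f. L (g ` f)) S 0 (h a) M (h b)"
      using S(1) that bi_spanner_iff_twalk[OF M'] by blast
    from twalk_image[OF this, of L g] show ?thesis using gh that by simp
  qed
  then have "bi_spanner A B L ((`) g ` S)" using sub by (simp add: bi_spanner_iff_twalk[OF M])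
  moreover have "card ((`) g ` S) \<le> spanner_bound m"
    using card_image_le[OF finS] S(2) le_trans by blast
  ultimately show ?thesis using finS by blast
qed

section \<open>Unbalanced bi-cliques\<close>

text \<open>
  If two targets \<open>b\<close>, \<open>b'\<close> have their latest edges to the same source \<open>x\<close>, with
  \<open>L {x, b} \<le> L {x, b'}\<close>, then every walk reaching \<open>b\<close> extends along \<open>b\<close>, \<open>x\<close>, \<open>b'\<close>.
\<close>

lemma bi_spanner_more_targets:
  assumes "biclique A B" "card A \<le> card B"
  shows "\<exists>S. bi_spanner A B L S \<and> finite S \<and> card S \<le> spanner_bound (card A) + 2 * (card B - card A)"
  using assms
proof (induction "card B - card A" arbitrary: B)
  case 0
  then show ?case using spanner_bound_any_type[of A B "card A" L] by simp
next
  case (Suc k)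
  have fin: "finite A" "finite B" and disj: "A \<inter> B = {}" using Suc.prems by (auto simp: biclique_def)
  show ?case
  proof (cases "A = {}")
    case True
    then show ?thesis by (intro exI[of _ "{}"]) (auto simp: bi_spanner_def)
  next
    case False
    have "\<exists>x. x \<in> A \<and> (\<forall>y\<in>A. L {y, b} \<le> L {x, b})" for b
    proof -
      have "Max ((\<lambda>y. L {y, b}) ` A) \<in> (\<lambda>y. L {y, b}) ` A" using fin False by (intro Max_in) auto
      then obtain x where x: "x \<in> A" "Max ((\<lambda>y. L {y, b}) ` A) = L {x, b}" by blast
      have "\<forall>y\<in>A. L {y, b} \<le> Max ((\<lambda>y. L {y, b}) ` A)" using fin by simp
      then show ?thesis using x by metis
    qed
    then obtain f where f: "\<And>b. f b \<in> A" "\<And>b y. y \<in> A \<Longrightarrow> L {y, b} \<le> L {f b, b}" by metis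
    \<comment> \<open>Pigeonhole: \<open>f\<close> sends each target to the source of its latest
      edge, and there are more targets than sources.\<close>
    have "\<not> inj_on f B" using card_inj_on_le[of f B A] f(1) fin Suc.hyps(2) by force
    then obtain b b' where b: "b \<in> B" "b' \<in> B" "b \<noteq> b'" "f b = f b'" "L {f b, b} \<le> L {f b, b'}"
      unfolding inj_on_def by (metis linear)
    define x where "x = f b"
    define B0 where "B0 = B - {b'}"
    have B0: "card B0 = card B - 1" "biclique A B0" "b \<in> B0" "B = insert b' B0"
      using b fin Suc.prems by (auto simp: B0_def biclique_def)
    have k: "k = card B0 - card A" "card A \<le> card B0" using Suc.hyps(2) B0 by auto
    obtain S where S: "bi_spanner A B0 L S" "finite S"
      "card S \<le> spanner_bound (card A) + 2 * (card B0 - card A)"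
      using Suc.hyps(1)[OF k(1) B0(2) k(2)] by blast
    let ?S = "S \<union> {{b, x}, {x, b'}}"
    obtain M where M: "\<forall>f\<in>biclique_edges A B. L f \<le> M" using labels_bounded[OF Suc.prems(1)] .
    have E0: "biclique_edges A B0 \<subseteq> biclique_edges A B"
      using biclique_edges_mono[of A A B0 B] by (auto simp: B0_def)
    then have M0: "\<forall>f\<in>biclique_edges A B0. L f \<le> M" using M by blast
    have xA: "x \<in> A" using f by (simp add: x_def)
    have new: "{b, x} \<in> biclique_edges A B" "{x, b'} \<in> biclique_edges A B"
      using xA b by (auto simp: biclique_edges_def insert_commute)
    have sub: "S \<subseteq> biclique_edges A B0" using S by (simp add: bi_spanner_def)
    have old: "twalk L S 0 a M c" if "a \<in> A" "c \<in> B0" for a c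
      using S(1) that bi_spanner_iff_twalk[OF M0] by blast
    have "twalk L ?S 0 a M c" if a: "a \<in> A" "c \<in> B" for a c
    proof (cases "c = b'")
      case False
      then have "twalk L S 0 a M c" using old a B0 by blast
      then show ?thesis by (rule twalk_mono) auto
    next
      case True
      \<comment> \<open>The edge from \<open>x\<close> is the latest at \<open>b\<close>, so every
        walk to \<open>b\<close> arrives early enough to continue along \<open>b\<close>,
        \<open>x\<close>, \<open>b'\<close>.\<close>
      have "\<forall>f\<in>S. b \<in> f \<longrightarrow> L f \<le> L {x, b}"
        using sub f(2) b(1) disj by (auto simp: x_def biclique_edges_def)
      then have "twalk L S 0 a (L {b, x}) b"
        using twalk_end_bounded[OF old[OF a(1) B0(3)], of "L {x, b}"] by (simp add: insert_commute)
      then have "twalk L ?S 0 a (L {b, x}) b" by (rule twalk_mono) auto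
      moreover have "twalk L ?S (L {x, b'}) x M b'"
        and "twalk L ?S (L {b, x}) b (L {x, b'}) x"
        using new M b(5) by (auto intro!: twalk_edge simp: x_def insert_commute)
      ultimately show ?thesis using True twalk_trans by metis
    qed
    then have "bi_spanner A B L ?S"
      using sub E0 new by (auto simp: bi_spanner_iff_twalk[OF M])
    moreover have "card ?S \<le> card S + 2"
      using card_Un_le[of S "{{b, x}, {x, b'}}"] card_insert_le_m1[of 2 "{{x, b'}}" "{b, x}"] by simp
    ultimately show ?thesis using S k Suc.hyps(2) by (intro exI[of _ ?S]) auto
  qed
qed

text \<open>Time reversal reduces this to the case of more targets.\<close>

lemma bi_spanner_more_sources:
  assumes bc: "biclique A B" and "card B \<le> card A"
  shows "\<exists>S. bi_spanner A B L S \<and> finite S \<and> card S \<le> spanner_bound (card B) + 2 * (card A - card B)"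
proof -
  obtain M where M: "\<forall>f\<in>biclique_edges A B. L f \<le> M" using labels_bounded[OF bc] .
  show ?thesis
    using bi_spanner_more_targets[OF biclique_commute[OF bc] assms(2), of "\<lambda>f. M - L f"]
      bi_spanner_reverse[of A B L "\<lambda>f. M - L f" M] M by auto
qed

section \<open>Trees into and out of an edge\<close>

text \<open>
  The tree grows greedily by the vertex with the latest possible departure; the invariant is that
  tree walks depart as late as walks in the whole graph.
\<close>

lemma in_tree_extend:
  assumes fin: "finite V" and V: "\<And>x. x \<in> V \<longleftrightarrow> (\<exists>v\<in>e. twalk L E 0 x (L e) v)"
    and "e \<subseteq> X" "X \<subseteq> V" "T \<subseteq> E" "e \<in> T" "finite T" "card T < card X"
    and "\<And>x s. x \<in> X \<Longrightarrow> \<exists>v\<in>e. twalk L E s x (L e) v \<Longrightarrow> \<exists>v\<in>e. twalk L T s x (L e) v"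
  shows "\<exists>T'\<subseteq>E. e \<in> T' \<and> finite T' \<and> card T' < card V \<and>
    (\<forall>x\<in>V. \<exists>v\<in>e. twalk L T' 0 x (L e) v)"
  using assms(3-)
proof (induction "card (V - X)" arbitrary: X T)
  case 0
  then have "X = V" using fin by auto
  moreover from this have "\<exists>v\<in>e. twalk L T 0 x (L e) v" if "x \<in> V" for x
    using 0(8)[of x 0] V that by simp
  ultimately show ?case using 0 by blast
next
  case (Suc k)
  \<comment> \<open>The times at which some vertex outside \<open>X\<close> can still set out and
    reach \<open>e\<close> by time \<open>L e\<close>.\<close>
  let ?D = "{s. \<exists>x\<in>V - X. \<exists>v\<in>e. twalk L E s x (L e) v}"
  have "?D \<subseteq> {..L e}" by (auto dest: twalk_le)
  then have finD: "finite ?D" by (rule finite_subset) simp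
  have "V - X \<noteq> {}" using Suc.hyps(2) by (metis card.empty nat.distinct(1))
  then obtain x0 where "x0 \<in> V - X" by blast
  then have "0 \<in> ?D" using V by blast
  then have "?D \<noteq> {}" by blast
  define s where "s = Max ?D"
  have "s \<in> ?D" using finD \<open>?D \<noteq> {}\<close> unfolding s_def by (rule Max_in)
  then obtain x v where xv: "x \<in> V - X" "v \<in> e" "twalk L E s x (L e) v" by blast
  \<comment> \<open>The vertex to attach is not \<open>x\<close> but \<open>y\<close>, where the
    walk of \<open>x\<close> crosses into \<open>X\<close>; the crossing edge has label at least
    \<open>s\<close>.\<close>
  then obtain y z where yz: "y \<notin> X" "z \<in> X" "{y, z} \<in> E" "s \<le> L {y, z}"
    "twalk L E (L {y, z}) z (L e) v"
    using twalk_enters[OF xv(3), of X] Suc.prems(1) by blast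
  have "twalk L E 0 y (L e) v" by (rule twalk.step[OF yz(3) _ yz(5)]) simp
  then have "y \<in> V" using V xv(2) by blast
  obtain v' where v': "v' \<in> e" "twalk L T (L {y, z}) z (L e) v'"
    using Suc.prems(7)[OF yz(2)] yz(5) xv(2) by blast
  let ?T = "insert {y, z} T" and ?X = "insert y X"
  have finX: "finite X" using Suc.prems(2) fin finite_subset by blast
  have "y \<in> V - X" using \<open>y \<in> V\<close> yz(1) by blast
  then have k: "k = card (V - ?X)"
    unfolding Diff_insert[of V y X] card_Diff_singleton[OF \<open>y \<in> V - X\<close>] Suc.hyps(2)[symmetric] by simp
  show ?case
  proof (rule Suc.hyps(1)[OF k])
    show "card ?T < card ?X"
      using Suc.prems(5,6) finX yz(1) by (simp add: card_insert_if)
  next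
    fix w r assume w: "w \<in> ?X" and r: "\<exists>v\<in>e. twalk L E r w (L e) v"
    show "\<exists>v\<in>e. twalk L ?T r w (L e) v"
    proof (cases "w \<in> X")
      case True
      then obtain u where "u \<in> e" "twalk L T r w (L e) u" using Suc.prems(7) r by metis
      moreover from this(2) have "twalk L ?T r w (L e) u" by (rule twalk_mono) auto
      ultimately show ?thesis by blast
    next
      case False
      then have [simp]: "w = y" using w by simp
      \<comment> \<open>By maximality of \<open>s\<close>, no walk from \<open>y\<close> into
        \<open>e\<close> can set out later than the new edge \<open>{y, z}\<close>, so the invariant
        extends to \<open>y\<close>.\<close>
      have "r \<in> ?D" using r yz(1) \<open>y \<in> V\<close> by auto
      then have "r \<le> s" using finD unfolding s_def by simp
      then have "r \<le> L {y, z}" using yz(4) by simp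
      moreover have "twalk L ?T (L {y, z}) z (L e) v'" by (rule twalk_mono[OF v'(2)]) auto
      ultimately have "twalk L ?T r y (L e) v'" by (rule twalk.step[OF insertI1])
      then show ?thesis using v'(1) by auto
    qed
  qed (use Suc.prems(1-5) yz(3) \<open>y \<in> V\<close> in auto)
qed

text \<open>Growth starts with \<open>X = e\<close> and \<open>T = {e}\<close>, one edge for two
  vertices. The walks without edges at the endpoints give the invariant.\<close>

lemma in_tree:
  assumes "finite V" "\<And>x. x \<in> V \<longleftrightarrow> (\<exists>v\<in>e. twalk L E 0 x (L e) v)" "e \<in> E" "card e = 2"
  shows "\<exists>T\<subseteq>E. e \<in> T \<and> finite T \<and> card T < card V \<and>
    (\<forall>x\<in>V. \<exists>v\<in>e. twalk L T 0 x (L e) v)"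
proof (rule in_tree_extend[OF assms(1,2), of e "{e}"])
  show "e \<subseteq> V"
  proof
    fix x assume "x \<in> e"
    moreover have "twalk L E 0 x (L e) x" by (rule twalk.refl) simp
    ultimately show "x \<in> V" using assms(2) by blast
  qed
  show "\<exists>v\<in>e. twalk L {e} s x (L e) v" if x: "x \<in> e" and ex: "\<exists>v\<in>e. twalk L E s x (L e) v" for x s
  proof -
    have "s \<le> L e" using ex by (auto dest: twalk_le)
    then have "twalk L {e} s x (L e) x" by (rule twalk.refl)
    then show ?thesis using x by blast
  qed
qed (use assms(3,4) in simp_all)

text \<open>Under the labels \<open>M - L f\<close>, walks out of \<open>e\<close> become walks into
  \<open>e\<close>, and \<open>in_tree\<close> applies.\<close>

lemma out_tree:
  assumes "finite V" "\<And>x. x \<in> V \<longleftrightarrow> (\<exists>v\<in>e. twalk L E (L e) v M x)" "e \<in> E" "card e = 2"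
    and M: "\<forall>f\<in>E. L f \<le> M"
  shows "\<exists>T\<subseteq>E. e \<in> T \<and> finite T \<and> card T < card V \<and>
    (\<forall>x\<in>V. \<exists>v\<in>e. twalk L T (L e) v M x)"
proof -
  let ?L = "\<lambda>f. M - L f"
  have rev: "twalk L T (L e) v M x \<longleftrightarrow> twalk ?L T 0 x (?L e) v" if "T \<subseteq> E" for T v x
    using twalk_reverse[of L T "L e" v M x ?L M] twalk_reverse[of ?L T 0 x "?L e" v L M]
      that M assms(3) by (auto simp: subset_iff)
  have "x \<in> V \<longleftrightarrow> (\<exists>v\<in>e. twalk ?L E 0 x (?L e) v)" for x
    using assms(2) rev[OF order_refl] by simp
  from in_tree[OF assms(1) this assms(3,4)]
  obtain T where "T \<subseteq> E" "e \<in> T" "finite T" "card T < card V"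
    "\<forall>x\<in>V. \<exists>v\<in>e. twalk ?L T 0 x (?L e) v" by blast
  then show ?thesis using rev[of T] by (intro exI[of _ T]) simp
qed

lemma In_edge_twalk:
  "x \<in> In_edge A B L e \<longleftrightarrow> (\<exists>v\<in>e. twalk L (biclique_edges A B) 0 x (L e) v)"
  by (auto simp: In_edge_def In_vertex_def twalk_le_iff_reaches)

lemma Out_edge_twalk:
  assumes "\<forall>f\<in>biclique_edges A B. L f \<le> M" "e \<in> biclique_edges A B"
  shows "x \<in> Out_edge A B L e \<longleftrightarrow> (\<exists>v\<in>e. twalk L (biclique_edges A B) (L e) v M x)"
  using assms by (auto simp: Out_edge_def Out_vertex_def twalk_ge_iff_reaches[of _ L M])

section \<open>Sets closed under a perfect matching\<close>

text \<open>Sending a vertex to its matching edge is a bijection. The right-hand side is symmetric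
  in \<open>A\<close> and \<open>B\<close>, so both parts of \<open>X\<close> have the same
  size.\<close>

lemma card_part_matching_closed:
  assumes bc: "biclique A B" and M: "perfect_matching A B M" and X: "X \<subseteq> A \<union> B"
    and closed: "\<And>e w. e \<in> M \<Longrightarrow> w \<in> e \<Longrightarrow> w \<in> X \<Longrightarrow> e \<subseteq> X"
  shows "card (A \<inter> X) = card {e \<in> M. e \<subseteq> X}"
proof -
  define h where "h v = (THE e. e \<in> M \<and> v \<in> e)" for v
  have h: "h v \<in> M" "v \<in> h v" if "v \<in> A \<union> B" for v
    using theI'[of "\<lambda>e. e \<in> M \<and> v \<in> e"] M that unfolding perfect_matching_def h_def by blast+
  have "bij_betw h (A \<inter> X) {e \<in> M. e \<subseteq> X}"
  proof (rule bij_betw_imageI)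
    show "inj_on h (A \<inter> X)"
    proof (rule inj_onI)
      fix u v assume uv: "u \<in> A \<inter> X" "v \<in> A \<inter> X" "h u = h v"
      then have "h u \<in> biclique_edges A B" "u \<in> h u" "v \<in> h u"
        using h perfect_matching_edge[OF M] by auto
      then show "u = v" using uv bc by (auto simp: biclique_edges_def biclique_def)
    qed
    show "h ` (A \<inter> X) = {e \<in> M. e \<subseteq> X}"
    proof
      show "h ` (A \<inter> X) \<subseteq> {e \<in> M. e \<subseteq> X}" using h closed by blast
      show "{e \<in> M. e \<subseteq> X} \<subseteq> h ` (A \<inter> X)"
      proof
        fix e assume e: "e \<in> {e \<in> M. e \<subseteq> X}"
        then obtain a b where "e = {a, b}" "a \<in> A" "b \<in> B"
          using perfect_matching_edge[OF M, of e] by (auto simp: biclique_edges_def)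
        then have a: "a \<in> A \<inter> X" "a \<in> e" using e by auto
        then have "e = h a" using perfect_matching_unique[OF M, of a e "h a"] h e by blast
        then show "e \<in> h ` (A \<inter> X)" using a by blast
      qed
    qed
  qed
  then show ?thesis by (rule bij_betw_same_card)
qed

lemma matching_closed_halves:
  assumes bc: "biclique A B" and M: "perfect_matching A B M" and X: "X \<subseteq> A \<union> B"
    and closed: "\<And>e w. e \<in> M \<Longrightarrow> w \<in> e \<Longrightarrow> w \<in> X \<Longrightarrow> e \<subseteq> X"
  shows "card (A \<inter> X) = card X div 2" "card (B \<inter> X) = card X div 2"
    "card X = 2 * (card X div 2)"
proof -
  have "perfect_matching B A M" using M
    unfolding perfect_matching_def by (simp add: biclique_edges_commute[of B A] Un_commute)
  then have "card (B \<inter> X) = card {e \<in> M. e \<subseteq> X}"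
    using card_part_matching_closed[OF biclique_commute[OF bc], of M X] X closed by blast
  moreover have "card (A \<inter> X) = card {e \<in> M. e \<subseteq> X}"
    using card_part_matching_closed[OF bc M X] closed by blast
  moreover have "card X = card (A \<inter> X) + card (B \<inter> X)"
    using bc X card_Un_disjoint[of "A \<inter> X" "B \<inter> X"]
    by (auto simp: biclique_def Int_Un_distrib2[symmetric] Int_absorb1)
  ultimately show "card (A \<inter> X) = card X div 2" "card (B \<inter> X) = card X div 2"
    "card X = 2 * (card X div 2)" by auto
qed

text \<open>Prepending the earliest edge at a vertex keeps a walk into \<open>e\<close> temporal, so
  the set is closed under the matching of earliest edges. This counts the sources outside
  it.\<close>

lemma In_edge_halves:
  assumes bc: "biclique A B" and m: "extremally_matched A B L" and e: "e \<in> biclique_edges A B"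
  shows "card (A \<inter> In_edge A B L e) = card (In_edge A B L e) div 2"
    "card (In_edge A B L e) = 2 * (card (In_edge A B L e) div 2)"
proof -
  let ?M = "{{v, pi_minus A B L v} | v. v \<in> A \<union> B}"
  have M: "perfect_matching A B ?M" using m unfolding extremally_matched_def by (elim conjE)
  have closed: "f \<subseteq> In_edge A B L e"
    if f: "f \<in> ?M" "w \<in> f" and w: "w \<in> In_edge A B L e" for f w
  proof -
    have wV: "w \<in> A \<union> B" using w In_edge_subset[OF e] by blast
    then have g: "{w, pi_minus A B L w} \<in> ?M" by blast
    then have "f = {w, pi_minus A B L w}"
      by (rule perfect_matching_unique[OF M wV f _ insertI1])
    then show ?thesis using pi_minus_In_edge[OF bc e w] perfect_matching_edge[OF M g] w by simp
  qed
  show "card (A \<inter> In_edge A B L e) = card (In_edge A B L e) div 2"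
    "card (In_edge A B L e) = 2 * (card (In_edge A B L e) div 2)"
    using matching_closed_halves[OF bc M In_edge_subset[OF e]] closed by simp_all
qed

text \<open>Dually, appending latest edges gives closure, which counts the targets outside the
  set.\<close>

lemma Out_edge_halves:
  assumes bc: "biclique A B" and m: "extremally_matched A B L" and e: "e \<in> biclique_edges A B"
  shows "card (B \<inter> Out_edge A B L e) = card (Out_edge A B L e) div 2"
    "card (Out_edge A B L e) = 2 * (card (Out_edge A B L e) div 2)"
proof -
  let ?M = "{{v, pi_plus A B L v} | v. v \<in> A \<union> B}"
  have M: "perfect_matching A B ?M" using m unfolding extremally_matched_def by (elim conjE)
  have closed: "f \<subseteq> Out_edge A B L e"
    if f: "f \<in> ?M" "w \<in> f" and w: "w \<in> Out_edge A B L e" for f w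
  proof -
    have wV: "w \<in> A \<union> B" using w Out_edge_subset[OF e] by blast
    then have g: "{w, pi_plus A B L w} \<in> ?M" by blast
    then have "f = {w, pi_plus A B L w}"
      by (rule perfect_matching_unique[OF M wV f _ insertI1])
    then show ?thesis using pi_plus_Out_edge[OF bc e w] perfect_matching_edge[OF M g] w by simp
  qed
  show "card (B \<inter> Out_edge A B L e) = card (Out_edge A B L e) div 2"
    "card (Out_edge A B L e) = 2 * (card (Out_edge A B L e) div 2)"
    using matching_closed_halves[OF bc M Out_edge_subset[OF e]] closed by simp_all
qed

section \<open>Assembling the spanner\<close>

text \<open>Two unbalanced spanners serve the sources outside \<open>In(e)\<close> and the targets
  outside \<open>Out(e)\<close>; the two trees serve the remaining pairs. Adding 3 on the left
  avoids truncated subtraction.\<close>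

lemma bi_spanner_through_edge:
  assumes bc: "biclique A B" and n: "card A = n" "card B = n"
    and m: "extremally_matched A B L" and e: "e \<in> biclique_edges A B"
  shows "\<exists>S. bi_spanner A B L S \<and>
    card S + 3 \<le> spanner_bound (n - card (In_edge A B L e) div 2)
      + spanner_bound (n - card (Out_edge A B L e) div 2)
      + 2 * card (In_edge A B L e) + 2 * card (Out_edge A B L e)"
proof -
  let ?E = "biclique_edges A B" and ?I = "In_edge A B L e" and ?O = "Out_edge A B L e"
  obtain M where M: "\<forall>f\<in>?E. L f \<le> M" using labels_bounded[OF bc] .
  have fin: "finite A" "finite B" using bc by (auto simp: biclique_def)
  have finI: "finite ?I" "finite ?O"
    using finite_subset[OF In_edge_subset[OF e]] finite_subset[OF Out_edge_subset[OF e]] fin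
    by simp_all
  obtain a0 b0 where ab: "e = {a0, b0}" "a0 \<noteq> b0"
    using e bc unfolding biclique_edges_def biclique_def by blast
  have e2: "card e = 2" using ab by simp
  obtain T1 where T1: "T1 \<subseteq> ?E" "e \<in> T1" "finite T1" "card T1 < card ?I"
    "\<forall>x\<in>?I. \<exists>v\<in>e. twalk L T1 0 x (L e) v"
    using in_tree[OF finI(1) In_edge_twalk e e2] by blast
  obtain T2 where T2: "T2 \<subseteq> ?E" "e \<in> T2" "finite T2" "card T2 < card ?O"
    "\<forall>x\<in>?O. \<exists>v\<in>e. twalk L T2 (L e) v M x"
    using out_tree[OF finI(2) Out_edge_twalk[OF M e] e e2 M] by blast
  note hI = In_edge_halves[OF bc m e] and hO = Out_edge_halves[OF bc m e]
  have cA: "card (A - ?I) = n - card ?I div 2" and cB: "card (B - ?O) = n - card ?O div 2"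
    using hI(1) hO(1) n fin by (simp_all add: card_Diff_subset_Int)
  have halfI: "card ?I div 2 \<le> n" "card ?O div 2 \<le> n"
    using half_card_le[OF bc n] In_edge_subset[OF e] Out_edge_subset[OF e] by blast+
  obtain S1 where S1: "bi_spanner (A - ?I) B L S1" "finite S1"
      "card S1 \<le> spanner_bound (n - card ?I div 2) + card ?I"
  proof -
    have "biclique (A - ?I) B" using bc by (auto simp: biclique_def)
    from bi_spanner_more_targets[OF this, of L] obtain S where "bi_spanner (A - ?I) B L S" "finite S"
      "card S \<le> spanner_bound (n - card ?I div 2) + 2 * (n - (n - card ?I div 2))"
      unfolding cA n by auto
    \<comment> \<open>Since \<open>card ?I\<close> is even, the surcharge
      \<open>2 * (n - (n - card ?I div 2))\<close> is exactly \<open>card ?I\<close>.\<close>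
    with that[of S] show ?thesis using hI(2) halfI(1) by simp
  qed
  obtain S2 where S2: "bi_spanner A (B - ?O) L S2" "finite S2"
      "card S2 \<le> spanner_bound (n - card ?O div 2) + card ?O"
  proof -
    have "biclique A (B - ?O)" using bc by (auto simp: biclique_def)
    from bi_spanner_more_sources[OF this, of L] obtain S where "bi_spanner A (B - ?O) L S" "finite S"
      "card S \<le> spanner_bound (n - card ?O div 2) + 2 * (n - (n - card ?O div 2))"
      unfolding cB n by auto
    with that[of S] show ?thesis using hO(2) halfI(2) by simp
  qed
  let ?S = "S1 \<union> S2 \<union> (T1 \<union> T2)"
  have sub: "S1 \<subseteq> ?E" "S2 \<subseteq> ?E"
    using S1(1) S2(1) biclique_edges_mono[of "A - ?I" A B B] biclique_edges_mono[of A A "B - ?O" B]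
    unfolding bi_spanner_def by blast+
  have "reaches L ?S a b" if "a \<in> A" "b \<in> B" for a b
  proof -
    consider "a \<notin> ?I" | "b \<notin> ?O" | "a \<in> ?I" "b \<in> ?O" by blast
    then show ?thesis
    proof cases
      case 1
      then have "reaches L S1 a b" using S1(1) that by (simp add: bi_spanner_def)
      then show ?thesis by (rule reaches_mono) auto
    next
      case 2
      then have "reaches L S2 a b" using S2(1) that by (simp add: bi_spanner_def)
      then show ?thesis by (rule reaches_mono) auto
    next
      case 3
      then obtain v w where vw: "v \<in> e" "w \<in> e" "twalk L T1 0 a (L e) v" "twalk L T2 (L e) w M b"
        using T1(5) T2(5) by blast
      \<comment> \<open>The two tree walks may meet \<open>e\<close> at different ends;
        \<open>e\<close> itself then joins them at time \<open>L e\<close>.\<close>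
      have "twalk L ?S (L e) v (L e) w"
      proof (cases "v = w")
        case False
        then have "{v, w} = e" using vw ab by auto
        then show ?thesis using T1(2) by (auto intro: twalk_edge)
      qed (simp add: twalk.refl)
      moreover have "twalk L ?S 0 a (L e) v" by (rule twalk_mono[OF vw(3)]) auto
      moreover have "twalk L ?S (L e) w M b" by (rule twalk_mono[OF vw(4)]) auto
      ultimately have "twalk L ?S 0 a M b" using twalk_trans by metis
      then show ?thesis using reaches_iff_twalk[of ?S L M] M sub T1(1) T2(1) by blast
    qed
  qed
  then have "bi_spanner A B L ?S" using sub T1(1) T2(1) by (auto simp: bi_spanner_def)
  moreover have "card ?S + 3 \<le> card S1 + card S2 + card ?I + card ?O"
  proof -
    have "e \<in> T1 \<inter> T2" using T1 T2 by blast
    then have "card (T1 \<inter> T2) \<ge> 1" using T1(3) by (simp add: Suc_le_eq card_gt_0_iff) blast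
    \<comment> \<open>Each tree has fewer edges than vertices, and the shared edge \<open>e\<close>
      saves one more.\<close>
    then have "card (T1 \<union> T2) + 3 \<le> card ?I + card ?O"
      using card_Un_Int[OF T1(3) T2(3)] T1(4) T2(4) by linarith
    then show ?thesis using card_Un_le[of S1 S2] card_Un_le[of "S1 \<union> S2" "T1 \<union> T2"] by linarith
  qed
  ultimately show ?thesis using S1(3) S2(3) by (intro exI[of _ ?S]) auto
qed

text \<open>\<open>ereal\<close> gives the infimum over no edges the value infinity. The halves are
  exact because both sets have even size, and 3 is subtracted in the reals.\<close>

theorem theorem23:
  fixes A B :: "'v set" and L :: "'v set \<Rightarrow> nat" and n :: nat
  assumes "biclique A B"
    and "card A = n" and "card B = n"
    and "extremally_matched A B L"
  shows "\<exists>S. bi_spanner A B L S \<and>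
    ereal (real (card S)) \<le>
      (INF e\<in>biclique_edges A B.
        ereal (real (spanner_bound (n - card (In_edge A B L e) div 2))
             + real (spanner_bound (n - card (Out_edge A B L e) div 2))
             + 2 * real (card (In_edge A B L e)) + 2 * real (card (Out_edge A B L e)) - 3))"
    (is "\<exists>S. _ \<and> _ \<le> (INF e\<in>?E. ereal (?f e))")
proof (cases "?E = {}")
  case True
  then show ?thesis using bi_spanner_all_edges[OF assms(1), of L] by (auto simp: top_ereal_def)
next
  case False
  \<comment> \<open>There are finitely many edges, so the minimum is attained and one spanner meets
    the bounds of all edges.\<close>
  define e where "e = arg_min_on ?f ?E"
  have fin: "finite ?E" using finite_biclique_edges[OF assms(1)] .
  have e: "e \<in> ?E" unfolding e_def using fin False by (rule arg_min_if_finite)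
  have min: "?f e \<le> ?f e'" if "e' \<in> ?E" for e'
    unfolding e_def using fin False that by (rule arg_min_least)
  obtain S where S: "bi_spanner A B L S" "card S + 3 \<le> spanner_bound (n - card (In_edge A B L e) div 2)
      + spanner_bound (n - card (Out_edge A B L e) div 2)
      + 2 * card (In_edge A B L e) + 2 * card (Out_edge A B L e)"
    using bi_spanner_through_edge[OF assms e] by blast
  have "real (card S) \<le> ?f e" using S(2) by linarith
  then have "ereal (real (card S)) \<le> (INF e\<in>?E. ereal (?f e))"
    using min by (intro INF_greatest) (simp only: ereal_less_eq, meson order_trans)
  then show ?thesis using S(1) by blast
qed

end
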